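(* For every integer $r\ge 5$, there exists a connected balanced bipartite graph $G$ with cycle rank $m(G)=r$ such that $G$ is a Parter graph but does not have a perfect matching.
   Context: All graphs are finite and simple, and all matrices are real and symmetric. For a graph $G$ with vertex set $\{1,\dots,n\}$, let $S(G)$ be the set of real symmetric $n\times n$ matrices $A=(a_{ij})$ such that for all $i\neq j$, $a_{ij}\neq 0$ if and only if $ij$ is an edge of $G$ (diagonal entries are arbitrary). For a vertex $v$, $A(v)$ denotes the principal submatrix of $A$ obtained by deleting the row and column indexed by $v$. A graph $G$ is called a Parter graph if there exists a nonsingular matrix $A\in S(G)$ such that $\det A(v)=0$ for every vertex $v$ of $G$ (equivalently, all diagonal entries of $A^{-1}$ are zero). The cycle rank of $G$ is $m(G)=|E(G)|-|V(G)|+k(G)$, where $k(G)$ is the number of connected components of $G$. A bipartite graph is balanced if its two partite sets have equal size. *)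

theory Defs
  imports
    "Graph_Theory.Pair_Digraph"
    "Graph_Theory.Digraph_Component"
    "Jordan_Normal_Form.Determinant"
begin

text \<open>
  A finite simple graph is a \<open>pair_graph\<close>: a finite, loop-free, symmetric set
  \<open>parcs G\<close> of ordered pairs over \<open>pverts G\<close>.  An undirected edge is therefore
  represented by two arcs; \<open>uedges\<close> forgets the orientation.
\<close>

definition uedges :: "'a pair_pre_digraph \<Rightarrow> 'a set set" where
  "uedges G = {{u, v} | u v. (u, v) \<in> parcs G}"

text \<open>
  Matrices of the library are indexed from 0, so the vertex set \<open>{1, \<dots>, n}\<close>
  becomes \<open>{0..<n}\<close>.
\<close>

definition graph_on :: "nat \<Rightarrow> nat pair_pre_digraph \<Rightarrow> bool" where
  "graph_on n G \<longleftrightarrow> pair_graph G \<and> pverts G = {0..<n}"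

text \<open>
  \<open>graph_mats G\<close> is the set usually written \<open>S(G)\<close>; vertices double as row and
  column indices, so it is meaningful only if \<open>graph_on n G\<close> holds for some \<open>n\<close>.
\<close>

definition graph_mats :: "nat pair_pre_digraph \<Rightarrow> real mat set" where
  "graph_mats G = {A \<in> carrier_mat (card (pverts G)) (card (pverts G)).
     transpose_mat A = A \<and>
     (\<forall>i \<in> pverts G. \<forall>j \<in> pverts G. i \<noteq> j \<longrightarrow>
        (A $$ (i, j) \<noteq> 0 \<longleftrightarrow> {i, j} \<in> uedges G))}"

definition parter_graph :: "nat pair_pre_digraph \<Rightarrow> bool" where
  "parter_graph G \<longleftrightarrow>
     (\<exists>A \<in> graph_mats G. det A \<noteq> 0 \<and> (\<forall>v \<in> pverts G. det (mat_delete A v v) = 0))"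

text \<open>
  For a symmetric digraph the strongly connected components \<open>sccs\<close> are the
  connected components of the underlying undirected graph.
\<close>

definition cycle_rank :: "'a pair_pre_digraph \<Rightarrow> int" where
  "cycle_rank G = int (card (uedges G)) - int (card (pverts G))
     + int (card (pre_digraph.sccs (with_proj G)))"

definition bipartition :: "'a pair_pre_digraph \<Rightarrow> 'a set \<Rightarrow> 'a set \<Rightarrow> bool" where
  "bipartition G X Y \<longleftrightarrow> X \<union> Y = pverts G \<and> X \<inter> Y = {} \<and>
     (\<forall>e \<in> uedges G. \<exists>x \<in> X. \<exists>y \<in> Y. e = {x, y})"

definition balanced_bipartite :: "'a pair_pre_digraph \<Rightarrow> bool" where
  "balanced_bipartite G \<longleftrightarrow> (\<exists>X Y. bipartition G X Y \<and> card X = card Y)"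

definition perfect_matching :: "'a pair_pre_digraph \<Rightarrow> 'a set set \<Rightarrow> bool" where
  "perfect_matching G M \<longleftrightarrow> M \<subseteq> uedges G \<and> (\<forall>v \<in> pverts G. \<exists>!e. e \<in> M \<and> v \<in> e)"

end

theory Submission
  imports Defs
begin

text \<open>
  Take hubs 0, 1, 2, 3, attach \<open>k\<close> leaves to both 0 and 1 and \<open>k\<close> leaves to both 2 and 3,
  and join the hubs by the edges 02, 13 and possibly 03.  The cycle rank is \<open>2k - 1\<close> or \<open>2k\<close>,
  and for \<open>k \<ge> 3\<close> the leaves on 0 and 1 violate Hall's condition.  The graph is nevertheless Parter:
  give every leaf the diagonal entry 2 and every leaf edge the entry 1, and eliminate the leaves.
  Writing \<open>N\<close> for the hub block of the inverse, a leaf has zero diagonal entry in the inverse iff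
  \<open>N\<^sub>0\<^sub>1 = N\<^sub>2\<^sub>3 = -1\<close>; the Schur complement \<open>N\<^sup>-\<^sup>1\<close> must therefore have entries \<open>-k/2\<close> at
  positions 01 and 23 because 01 and 23 are not edges.  With \<open>N\<close> of zero diagonal and \<open>N\<^sub>0\<^sub>3 = 0\<close>
  this forces \<open>N\<^sub>0\<^sub>2 N\<^sub>1\<^sub>3 = (k - 2)/k\<close>, while \<open>N\<^sub>1\<^sub>2\<close> remains free and is nonzero exactly when 03
  is an edge.
\<close>

section \<open>Principal minors and the diagonal of the inverse\<close>

text \<open>The adjugate of \<open>A\<close> equals \<open>det A\<close> times \<open>C\<close>, and
  its diagonal cofactors carry the sign +1. The Parter condition thus becomes a zero diagonal of an
  explicit inverse.\<close>

lemma det_mat_delete_right_inverse: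
  fixes A C :: "'a :: field mat"
  assumes A: "A \<in> carrier_mat n n" and C: "C \<in> carrier_mat n n" and AC: "A * C = 1\<^sub>m n"
  shows "det A \<noteq> 0"
    and "v < n \<Longrightarrow> det (mat_delete A v v) = det A * C $$ (v, v)"
proof -
  have "det A * det C = 1"
    using det_mult[OF A C] AC by simp
  then show "det A \<noteq> 0" by auto
next
  assume v: "v < n"
  have "adj_mat A = adj_mat A * (A * C)"
    using AC adj_mat(1)[OF A] by simp
  also have "\<dots> = (det A \<cdot>\<^sub>m 1\<^sub>m n) * C"
    using A C adj_mat[OF A] by (simp flip: assoc_mult_mat)
  also have "\<dots> = det A \<cdot>\<^sub>m C"
    using mult_smult_assoc_mat[OF one_carrier_mat C] C by simp
  finally have "adj_mat A $$ (v, v) = det A * C $$ (v, v)"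
    using C v by simp
  then show "det (mat_delete A v v) = det A * C $$ (v, v)"
    using A v by (simp add: adj_mat_def cofactor_def)
qed

section \<open>Graphs generated by one orientation of their edges\<close>

definition sym_graph :: "'a set \<Rightarrow> 'a rel \<Rightarrow> 'a pair_pre_digraph" where
  "sym_graph V F = \<lparr>pverts = V, parcs = F \<union> F\<inverse>\<rparr>"

lemma sym_graph_simps [simp]:
  "pverts (sym_graph V F) = V"
  "parcs (sym_graph V F) = F \<union> F\<inverse>"
  by (simp_all add: sym_graph_def)

lemma uedges_sym_graph: "uedges (sym_graph V F) = (\<lambda>(u, v). {u, v}) ` F"
  unfolding uedges_def by (auto simp: insert_commute)

lemma doubleton_in_uedges_sym_graph:
  "{u, v} \<in> uedges (sym_graph V F) \<longleftrightarrow> (u, v) \<in> F \<or> (v, u) \<in> F"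
  unfolding uedges_sym_graph by (auto simp: doubleton_eq_iff image_iff split: prod.splits)

lemma pair_graph_sym_graph:
  assumes "finite V" "F \<subseteq> X \<times> Y" "X \<union> Y = V" "X \<inter> Y = {}"
  shows "pair_graph (sym_graph V F)"
proof -
  have "finite F"
    using assms by (meson finite_SigmaI finite_Un finite_subset)
  moreover have "u \<in> V \<and> v \<in> V" if "(u, v) \<in> F" for u v
    using assms(2,3) that by auto
  moreover have "(u, u) \<notin> F" for u
    using assms(2,4) by auto
  moreover have "sym (F \<union> F\<inverse>)"
    by (simp add: sym_Un_converse)
  ultimately show ?thesis
    using assms(1) by unfold_locales (auto simp: symmetric_def)
qed

lemma bipartition_sym_graph:
  assumes "F \<subseteq> X \<times> Y" "X \<union> Y = V" "X \<inter> Y = {}"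
  shows "bipartition (sym_graph V F) X Y"
proof -
  have "\<exists>x \<in> X. \<exists>y \<in> Y. e = {x, y}" if "e \<in> uedges (sym_graph V F)" for e
  proof -
    from that obtain x y where "(x, y) \<in> F" "e = {x, y}"
      unfolding uedges_sym_graph by auto
    moreover from this have "x \<in> X" "y \<in> Y" using assms(1) by auto
    ultimately show ?thesis by auto
  qed
  with assms(2,3) show ?thesis
    unfolding bipartition_def by simp
qed

text \<open>Disjoint sides keep \<open>F\<close> from containing an arc and its reverse, so
  forgetting the orientation is injective.\<close>

lemma card_uedges_sym_graph:
  assumes "F \<subseteq> X \<times> Y" "X \<inter> Y = {}"
  shows "card (uedges (sym_graph V F)) = card F"
proof -
  have "(v, u) \<notin> F" if "(u, v) \<in> F" for u v
    using assms that by auto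
  then have "inj_on (\<lambda>(u, v). {u, v}) F"
    by (auto simp: inj_on_def doubleton_eq_iff)
  then show ?thesis
    unfolding uedges_sym_graph by (rule card_image)
qed

section \<open>Connectedness and the number of components\<close>

lemma (in sym_digraph) strongly_connected_if_reach_root:
  assumes "x \<in> verts G" "\<And>v. v \<in> verts G \<Longrightarrow> v \<rightarrow>\<^sup>* x"
  shows "strongly_connected G"
proof (rule strongly_connectedI)
  show "u \<rightarrow>\<^sup>* v" if "u \<in> verts G" "v \<in> verts G" for u v
    using reachable_trans[OF assms(2)[OF that(1)] symmetric_reachable'[OF assms(2)[OF that(2)]]] .
qed (use assms(1) in auto)

lemma (in sym_digraph) strongly_connected_imp_connected:
  assumes "strongly_connected G"
  shows "connected G"
  using assms sym_arcs unfolding strongly_connected_def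
  by (intro connectedI) (auto simp: reachable_mk_symmetric_eq)

text \<open>\<open>G\<close> is an induced subgraph of itself and contains every other one, so only
  \<open>G\<close> can be maximal. This makes the component count in the cycle rank equal to
  1.\<close>

lemma (in wf_digraph) sccs_strongly_connected:
  assumes "strongly_connected G"
  shows "sccs = {G}"
proof -
  have G: "induced_subgraph G G"
    by (auto simp: induced_subgraph_def subgraph_def compatible_def wf_digraph_axioms
        dest: wellformed)
  have sub: "verts H \<subseteq> verts G" if "induced_subgraph H G" for H
    using that by (simp add: induced_subgraph_def subgraph_def)
  show ?thesis
  proof (intro equalityI subsetI)
    fix H assume "H \<in> sccs"
    then have H: "induced_subgraph H G" and "\<not> verts H \<subset> verts G"
      using assms G unfolding sccs_def by auto
    with sub have verts: "verts H = verts G" by blast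
    have "arcs H = arcs G"
      using H verts by (auto simp: induced_subgraph_def)
    then have "H = G"
      using H verts by (auto simp: induced_subgraph_def subgraph_def compatible_def)
    then show "H \<in> {G}" by simp
  next
    fix H assume "H \<in> {G}"
    moreover have "G \<in> sccs"
      using G assms by (rule in_sccsI) (auto dest: sub)
    ultimately show "H \<in> sccs" by simp
  qed
qed

section \<open>The family of graphs and its combinatorics\<close>

text \<open>Arcs depend only on the classes of their ends, and matrix entries do so up to a diagonal
  term on the leaves. Claims for all \<open>k\<close> thereby reduce to checks on six
  classes.\<close>

definition vclass :: "nat \<Rightarrow> nat \<Rightarrow> nat" where
  "vclass k i = (if i < 4 then i else if i < 4 + k then 4 else 5)"

text \<open>
  Classes 0 to 3 are the single hubs; 4 and 5 are the leaves on hubs 0, 1 and on hubs 2, 3.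
  All arcs point from one side of the bipartition to the other.
\<close>

definition pattern_arcs :: "bool \<Rightarrow> nat rel" where
  "pattern_arcs d = {(0, 4), (1, 4), (5, 2), (5, 3), (0, 2), (1, 3)} \<union> (if d then {(0, 3)} else {})"

definition blowup_arcs :: "nat \<Rightarrow> bool \<Rightarrow> nat rel" where
  "blowup_arcs k d = {(i, j). i < 2 * k + 4 \<and> j < 2 * k + 4 \<and> (vclass k i, vclass k j) \<in> pattern_arcs d}"

definition blowup_graph :: "nat \<Rightarrow> bool \<Rightarrow> nat pair_pre_digraph" where
  "blowup_graph k d = sym_graph {0..<2 * k + 4} (blowup_arcs k d)"

lemma vclass_less: "vclass k i < 6"
  by (simp add: vclass_def)

lemma vclass_eq_iff:
  "vclass k i = 0 \<longleftrightarrow> i = 0"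
  "vclass k i = Suc 0 \<longleftrightarrow> i = 1"
  "vclass k i = 2 \<longleftrightarrow> i = 2"
  "vclass k i = 3 \<longleftrightarrow> i = 3"
  "vclass k i = 4 \<longleftrightarrow> 4 \<le> i \<and> i < 4 + k"
  "vclass k i = 5 \<longleftrightarrow> 4 + k \<le> i"
  by (auto simp: vclass_def)

lemma blowup_arcs_eq:
  "blowup_arcs k d = {0, 1} \<times> {4..<4 + k} \<union> {4 + k..<2 * k + 4} \<times> {2, 3} \<union>
     ({(0, 2), (1, 3)} \<union> (if d then {(0, 3)} else {}))"
  (is "_ = ?R")
proof (intro equalityI subrelI)
  fix i j assume "(i, j) \<in> blowup_arcs k d"
  then have ij: "i < 2 * k + 4" "j < 2 * k + 4" and
    "(vclass k i, vclass k j) \<in> pattern_arcs d"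
    by (simp_all add: blowup_arcs_def)
  then consider "vclass k i = 0" "vclass k j = 4" | "vclass k i = 1" "vclass k j = 4"
    | "vclass k i = 5" "vclass k j = 2" | "vclass k i = 5" "vclass k j = 3"
    | "vclass k i = 0" "vclass k j = 2" | "vclass k i = 1" "vclass k j = 3"
    | "vclass k i = 0" "vclass k j = 3" d
    unfolding pattern_arcs_def by (auto split: if_splits)
  then show "(i, j) \<in> ?R"
    by cases (use ij in \<open>simp_all add: vclass_eq_iff\<close>)
next
  fix i j assume "(i, j) \<in> ?R"
  then consider "i \<in> {0, 1}" "4 \<le> j" "j < 4 + k" | "4 + k \<le> i" "i < 2 * k + 4" "j \<in> {2, 3}"
    | "i = 0" "j = 2" | "i = 1" "j = 3" | "i = 0" "j = 3" d
    by (auto split: if_splits)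
  then show "(i, j) \<in> blowup_arcs k d"
    by cases (auto simp: blowup_arcs_def pattern_arcs_def vclass_def)
qed

text \<open>Each side consists of two hubs and the \<open>k\<close> leaves attached to the other two
  hubs, which also makes the sides equal in size.\<close>

lemma blowup_arcs_subset:
  "blowup_arcs k d \<subseteq> ({0, 1} \<union> {4 + k..<2 * k + 4}) \<times> ({2, 3} \<union> {4..<4 + k})"
  unfolding blowup_arcs_eq by (auto split: if_splits)

lemma blowup_parts:
  "({0, 1} \<union> {4 + k..<2 * k + 4}) \<union> ({2, 3} \<union> {4..<4 + k}) = {0..<2 * k + 4 :: nat}"
  "({0, 1} \<union> {4 + k..<2 * k + 4}) \<inter> ({2, 3} \<union> {4..<4 + k :: nat}) = {}"
  by auto

lemma card_blowup_arcs: "card (blowup_arcs k d) = 4 * k + 2 + of_bool d"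
proof -
  have "({0, 1} \<times> {4..<4 + k}) \<inter> ({4 + k..<2 * k + 4} \<times> {2, 3 :: nat}) = {}"
    by auto
  then have "card ({0, 1} \<times> {4..<4 + k} \<union> {4 + k..<2 * k + 4} \<times> {2, 3 :: nat}) = 4 * k"
    by (simp add: card_Un_disjoint card_cartesian_product)
  moreover have "card ({(0, 2), (1, 3)} \<union> (if d then {(0, 3)} else {} :: nat rel)) = 2 + of_bool d"
    by simp
  moreover have "({0, 1} \<times> {4..<4 + k} \<union> {4 + k..<2 * k + 4} \<times> {2, 3}) \<inter>
      ({(0, 2), (1, 3)} \<union> (if d then {(0, 3)} else {} :: nat rel)) = {}"
    by simp
  ultimately show ?thesis
    unfolding blowup_arcs_eq by (subst card_Un_disjoint) simp_all
qed

lemma pair_graph_blowup: "pair_graph (blowup_graph k d)"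
  unfolding blowup_graph_def
  using pair_graph_sym_graph[OF _ blowup_arcs_subset blowup_parts] by simp

lemma balanced_bipartite_blowup: "balanced_bipartite (blowup_graph k d)"
proof -
  have "card ({0, 1} \<union> {4 + k..<2 * k + 4}) = 2 + k" "card ({2, 3} \<union> {4..<4 + k}) = 2 + k"
    by (subst card_Un_disjoint; auto)+
  then show ?thesis
    unfolding balanced_bipartite_def blowup_graph_def
    using bipartition_sym_graph[OF blowup_arcs_subset blowup_parts] by metis
qed

lemma strongly_connected_blowup:
  assumes "k > 0"
  shows "strongly_connected (with_proj (blowup_graph k d))"
proof -
  let ?G = "blowup_graph k d"
  interpret pair_graph ?G by (rule pair_graph_blowup)
  have adj: "u \<rightarrow>\<^sup>*\<^bsub>?G\<^esub> v"
    if "(u, v) \<in> blowup_arcs k d \<or> (v, u) \<in> blowup_arcs k d" for u v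
    using that by (intro reachable_adjI) (auto simp: blowup_graph_def)
  have leaf1: "u \<rightarrow>\<^sup>*\<^bsub>?G\<^esub> 0" "1 \<rightarrow>\<^sup>*\<^bsub>?G\<^esub> u" if "u \<in> {4..<4 + k}" for u
    using that by (auto intro!: adj simp: blowup_arcs_eq)
  \<comment> \<open>Vertex 4 is a common neighbour of hubs 0 and 1; it is a leaf of the first kind
    because \<open>k > 0\<close>.\<close>
  have h1: "1 \<rightarrow>\<^sup>*\<^bsub>?G\<^esub> 0"
    using leaf1[of 4] assms reachable_trans by simp
  have h2: "2 \<rightarrow>\<^sup>*\<^bsub>?G\<^esub> 0" and h31: "3 \<rightarrow>\<^sup>*\<^bsub>?G\<^esub> 1"
    by (auto intro!: adj simp: blowup_arcs_eq)
  have leaf2: "u \<rightarrow>\<^sup>*\<^bsub>?G\<^esub> 0" if "u \<in> {4 + k..<2 * k + 4}" for u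
    using that by (intro reachable_trans[OF _ h2] adj) (auto simp: blowup_arcs_eq)
  show ?thesis
  proof (rule strongly_connected_if_reach_root)
    show "0 \<in> pverts ?G" by (simp add: blowup_graph_def)
  next
    fix v assume "v \<in> pverts ?G"
    then have "v = 0 \<or> v = 1 \<or> v = 2 \<or> v = 3 \<or> v \<in> {4..<4 + k} \<or> v \<in> {4 + k..<2 * k + 4}"
      by (auto simp: blowup_graph_def)
    then show "v \<rightarrow>\<^sup>*\<^bsub>?G\<^esub> 0"
      using h1 h2 reachable_trans[OF h31 h1] leaf1(1) leaf2 \<open>v \<in> pverts ?G\<close>
      by (auto simp: reachable_refl)
  qed
qed

lemma connected_blowup:
  assumes "k > 0"
  shows "Digraph_Component.connected (with_proj (blowup_graph k d))"
proof -
  interpret pair_graph "blowup_graph k d" by (rule pair_graph_blowup)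
  show ?thesis
    using strongly_connected_imp_connected[OF strongly_connected_blowup[OF assms]] .
qed

lemma cycle_rank_blowup:
  assumes "k > 0"
  shows "cycle_rank (blowup_graph k d) = 2 * int k - 1 + of_bool d"
proof -
  interpret pair_graph "blowup_graph k d" by (rule pair_graph_blowup)
  have "card (uedges (blowup_graph k d)) = 4 * k + 2 + of_bool d"
    unfolding blowup_graph_def
    using card_uedges_sym_graph[OF blowup_arcs_subset blowup_parts(2)] card_blowup_arcs by simp
  then show ?thesis
    unfolding cycle_rank_def sccs_strongly_connected[OF strongly_connected_blowup[OF assms]]
    by (simp add: blowup_graph_def)
qed

text \<open>For \<open>k \<ge> 3\<close> the vertices 4, 5, 6 are leaves whose only neighbours are
  hubs 0 and 1, so by pigeonhole two of them would be matched to the same hub.\<close>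

lemma no_perfect_matching_blowup:
  assumes "k \<ge> 3"
  shows "\<not> perfect_matching (blowup_graph k d) M"
proof
  assume M: "perfect_matching (blowup_graph k d) M"
  have partner: "\<exists>h \<in> {0, 1}. {h, u} \<in> M" if u: "u \<in> {4, 5, 6}" for u
  proof -
    have "u \<in> pverts (blowup_graph k d)"
      using u assms by (auto simp: blowup_graph_def)
    then obtain e where e: "e \<in> M" "u \<in> e" "e \<in> uedges (blowup_graph k d)"
      using M unfolding perfect_matching_def by blast
    then obtain a b where "(a, b) \<in> blowup_arcs k d" "e = {a, b}"
      unfolding blowup_graph_def uedges_sym_graph by auto
    with e u assms show ?thesis
      unfolding blowup_arcs_eq by (auto split: if_splits)
  qed
  have unique: "u = v" if "h \<in> {0, 1}" "{h, u} \<in> M" "{h, v} \<in> M" for h u v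
  proof -
    have "h \<in> pverts (blowup_graph k d)"
      using that by (auto simp: blowup_graph_def)
    then have "\<exists>!e. e \<in> M \<and> h \<in> e"
      using M unfolding perfect_matching_def by simp
    then have "{h, u} = {h, v}"
      using that by (metis insertI1)
    then show ?thesis by (auto simp: doubleton_eq_iff)
  qed
  obtain a b c where "a \<in> {0, 1}" "{a, 4} \<in> M" "b \<in> {0, 1}" "{b, 5} \<in> M" "c \<in> {0, 1}" "{c, 6} \<in> M"
    using partner[of 4] partner[of 5] partner[of 6] by blast
  moreover from this have "a = b \<or> a = c \<or> b = c" by auto
  ultimately show False
    using unique[of a 4 5] unique[of a 4 6] unique[of b 5 6] by auto
qed

section \<open>Block-constant matrices and an explicit inverse pair\<close>

text \<open>Matrices constant on class blocks are not enough, since a leaf block needs its own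
  diagonal; adding \<open>c\<close> there gives a family closed under products.\<close>

definition blowup_mat :: "nat \<Rightarrow> (nat \<Rightarrow> nat \<Rightarrow> real) \<Rightarrow> real \<Rightarrow> real mat" where
  "blowup_mat k P c = mat (2 * k + 4) (2 * k + 4)
     (\<lambda>(i, j). P (vclass k i) (vclass k j) + (if i = j \<and> 4 \<le> i then c else 0))"

lemma blowup_mat_carrier [simp]: "blowup_mat k P c \<in> carrier_mat (2 * k + 4) (2 * k + 4)"
  by (simp add: blowup_mat_def)

lemma vclass_ge_4_iff [simp]: "4 \<le> vclass k i \<longleftrightarrow> 4 \<le> i"
  by (simp add: vclass_def)

lemma sum_vclass:
  fixes f :: "nat \<Rightarrow> real"
  shows "(\<Sum>l = 0..<2 * k + 4. f (vclass k l)) = f 0 + f 1 + f 2 + f 3 + k * f 4 + k * f 5"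
proof -
  have "{0..<2 * k + 4} = {0, 1, 2, 3} \<union> ({4..<4 + k} \<union> {4 + k..<2 * k + 4})"
    by auto
  then have "(\<Sum>l = 0..<2 * k + 4. f (vclass k l)) =
      (\<Sum>l \<in> {0, 1, 2, 3}. f (vclass k l)) +
      ((\<Sum>l = 4..<4 + k. f (vclass k l)) + (\<Sum>l = 4 + k..<2 * k + 4. f (vclass k l)))"
    by (simp only:, subst sum.union_disjoint, auto simp: sum.union_disjoint)
  also have "(\<Sum>l = 4..<4 + k. f (vclass k l)) = (\<Sum>l = 4..<4 + k. f 4)"
    by (rule sum.cong) (auto simp: vclass_def)
  also have "(\<Sum>l = 4 + k..<2 * k + 4. f (vclass k l)) = (\<Sum>l = 4 + k..<2 * k + 4. f 5)"
    by (rule sum.cong) (auto simp: vclass_def)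
  finally show ?thesis
    by (simp add: vclass_def)
qed

lemma blowup_mat_mult:
  "blowup_mat k P c * blowup_mat k Q e = blowup_mat k
     (\<lambda>a b. P a 0 * Q 0 b + P a 1 * Q 1 b + P a 2 * Q 2 b + P a 3 * Q 3 b
        + k * (P a 4 * Q 4 b) + k * (P a 5 * Q 5 b)
        + (if 4 \<le> a then c * Q a b else 0) + (if 4 \<le> b then e * P a b else 0)) (c * e)"
  (is "_ = blowup_mat k ?R _")
proof (rule eq_matI)
  fix i j
  assume "i < dim_row (blowup_mat k ?R (c * e))" "j < dim_col (blowup_mat k ?R (c * e))"
  then have ij: "i < 2 * k + 4" "j < 2 * k + 4"
    by (simp_all add: blowup_mat_def)
  let ?i = "vclass k i" and ?j = "vclass k j"
  have "(blowup_mat k P c * blowup_mat k Q e) $$ (i, j) = (\<Sum>l = 0..<2 * k + 4.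
      (P ?i (vclass k l) + (if i = l \<and> 4 \<le> i then c else 0)) *
      (Q (vclass k l) ?j + (if l = j \<and> 4 \<le> l then e else 0)))"
    using ij by (simp add: blowup_mat_def scalar_prod_def)
  \<comment> \<open>Expanding the product, each diagonal contribution is written as an indicator of
    a single \<open>l\<close>, so that its sum collapses to one term.\<close>
  also have "\<dots> = (\<Sum>l = 0..<2 * k + 4. P ?i (vclass k l) * Q (vclass k l) ?j
      + (if i = l then if 4 \<le> i then c * Q ?i ?j else 0 else 0)
      + (if j = l then if 4 \<le> j then e * P ?i ?j else 0 else 0)
      + (if i = l then if i = j \<and> 4 \<le> i then c * e else 0 else 0))"
    by (rule sum.cong) (auto simp: algebra_simps)
  also have "\<dots> = blowup_mat k ?R (c * e) $$ (i, j)"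
    using ij by (simp add: sum.distrib sum_vclass[where f = "\<lambda>l. P ?i l * Q l ?j"] blowup_mat_def)
  finally show "(blowup_mat k P c * blowup_mat k Q e) $$ (i, j) = blowup_mat k ?R (c * e) $$ (i, j)" .
qed (simp_all add: blowup_mat_def)

lemma blowup_mat_eqI:
  assumes "\<And>a b. a < 6 \<Longrightarrow> b < 6 \<Longrightarrow> P a b = Q a b" and "c = e"
  shows "blowup_mat k P c = blowup_mat k Q e"
  unfolding blowup_mat_def using assms(1)[OF vclass_less vclass_less] assms(2) by auto

lemma one_blowup_mat: "1\<^sub>m (2 * k + 4) = blowup_mat k (\<lambda>a b. of_bool (a = b \<and> a < 4)) 1"
  by (rule eq_matI) (auto simp: blowup_mat_def vclass_def)

text \<open>
  Here \<open>x\<close> stands for \<open>k\<close>, and \<open>t\<close> is 1 or 0 according to whether the edge 03 is present.  In the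
  inverse pattern the leaf blocks have diagonal entries \<open>- 1 / 2\<close>, which the additional diagonal
  \<open>1 / 2\<close> of \<open>blowup_mat\<close> cancels.
\<close>

definition parter_pattern :: "real \<Rightarrow> real \<Rightarrow> nat \<Rightarrow> nat \<Rightarrow> real" where
  "parter_pattern x t a b = [
     [x / 2 - t * (x - 2), 0, - (x - 2) / 2, - t * (x - 1), 1, 0],
     [0, x / 2, 0, - x / 2, 1, 0],
     [- (x - 2) / 2, 0, x / 2, 0, 0, 1],
     [- t * (x - 1), - x / 2, 0, x / 2 - t * x, 0, 1],
     [1, 1, 0, 0, 0, 0],
     [0, 0, 1, 1, 0, 0]] ! a ! b"

text \<open>The hub block is \<open>N\<close>, normalised by \<open>1\<close> at position 02 and
  with the free entry 12 set to \<open>2 * t / x\<close>. By block inversion, hub-leaf entries are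
  \<open>- 1 / 2\<close> times sums of two entries of \<open>N\<close>, and leaf-leaf entries are
  quarter sums of its 2 by 2 blocks.\<close>

definition parter_inverse_pattern :: "real \<Rightarrow> real \<Rightarrow> nat \<Rightarrow> nat \<Rightarrow> real" where
  "parter_inverse_pattern x t a b = [
     [0, - 1, 1, 0, 1 / 2, - 1 / 2],
     [- 1, 0, 2 * t / x, (x - 2) / x, 1 / 2, - (2 * t + x - 2) / (2 * x)],
     [1, 2 * t / x, 0, - 1, - (2 * t + x) / (2 * x), 1 / 2],
     [0, (x - 2) / x, - 1, 0, - (x - 2) / (2 * x), 1 / 2],
     [1 / 2, 1 / 2, - (2 * t + x) / (2 * x), - (x - 2) / (2 * x), - 1 / 2, (t + x - 1) / (2 * x)],
     [- 1 / 2, - (2 * t + x - 2) / (2 * x), 1 / 2, 1 / 2, (t + x - 1) / (2 * x), - 1 / 2]] ! a ! b"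

lemma less_6_cases: "a < (6 :: nat) \<longleftrightarrow> a = 0 \<or> a = 1 \<or> a = 2 \<or> a = 3 \<or> a = 4 \<or> a = 5"
  by auto

lemma parter_pattern_commute:
  assumes "a < 6" "b < 6"
  shows "parter_pattern x t a b = parter_pattern x t b a"
  using assms unfolding less_6_cases by (elim disjE) (simp_all add: parter_pattern_def)

text \<open>The bound \<open>x > 2\<close> keeps the entry \<open>- (x - 2) / 2\<close> of the edge
  02 nonzero.\<close>

lemma parter_pattern_nonzero_iff:
  assumes "a < 6" "b < 6" "a \<noteq> b" "x > 2"
  shows "parter_pattern x (of_bool d) a b \<noteq> 0 \<longleftrightarrow>
    (a, b) \<in> pattern_arcs d \<or> (b, a) \<in> pattern_arcs d"
  using assms unfolding less_6_cases
  by (elim disjE) (auto simp: parter_pattern_def pattern_arcs_def)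

text \<open>Comparing patterns leaves 36 rational identities in \<open>k\<close> and
  \<open>t\<close>, verified by clearing the denominators.\<close>

lemma parter_mat_mult_inverse:
  assumes "k > 0"
  shows "blowup_mat k (parter_pattern k t) 2 * blowup_mat k (parter_inverse_pattern k t) (1 / 2) =
    1\<^sub>m (2 * k + 4)"
proof -
  have "real k \<noteq> 0" using assms by simp
  then show ?thesis
    unfolding blowup_mat_mult one_blowup_mat
    by (intro blowup_mat_eqI, unfold less_6_cases, elim disjE)
       (simp_all add: parter_pattern_def parter_inverse_pattern_def divide_simps,
        simp_all add: algebra_simps)
qed

section \<open>The Parter property and the choice of parameters\<close>

lemma parter_graph_blowup:
  assumes "k \<ge> 3"
  shows "parter_graph (blowup_graph k d)"
proof -
  define A where "A = blowup_mat k (parter_pattern k (of_bool d)) 2"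
  define C where "C = blowup_mat k (parter_inverse_pattern k (of_bool d)) (1 / 2)"
  have car: "A \<in> carrier_mat (2 * k + 4) (2 * k + 4)" "C \<in> carrier_mat (2 * k + 4) (2 * k + 4)"
    by (simp_all add: A_def C_def)
  have AC: "A * C = 1\<^sub>m (2 * k + 4)"
    unfolding A_def C_def using parter_mat_mult_inverse assms by simp
  have "transpose_mat A = A"
    by (rule eq_matI)
       (auto simp: A_def blowup_mat_def parter_pattern_commute[OF vclass_less vclass_less])
  moreover have "A $$ (i, j) \<noteq> 0 \<longleftrightarrow> {i, j} \<in> uedges (blowup_graph k d)"
    if "i < 2 * k + 4" "j < 2 * k + 4" "i \<noteq> j" for i j
  proof -
    have A_ij: "A $$ (i, j) = parter_pattern k (of_bool d) (vclass k i) (vclass k j)"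
      using that by (simp add: A_def blowup_mat_def)
    have edge: "{i, j} \<in> uedges (blowup_graph k d) \<longleftrightarrow>
        (vclass k i, vclass k j) \<in> pattern_arcs d \<or> (vclass k j, vclass k i) \<in> pattern_arcs d"
      using that by (simp add: blowup_graph_def doubleton_in_uedges_sym_graph blowup_arcs_def)
    show ?thesis
    proof (cases "vclass k i = vclass k j")
      case True
      \<comment> \<open>Distinct vertices share a class only if both are leaves; there the pattern
        entry is 0 and no arc exists.\<close>
      with that have "vclass k j = 4 \<or> vclass k j = 5"
        by (auto simp: vclass_def split: if_splits)
      with True show ?thesis
        unfolding A_ij edge by (auto simp: parter_pattern_def pattern_arcs_def)
    next
      case False
      then show ?thesis
        unfolding A_ij edge
        using assms by (intro parter_pattern_nonzero_iff vclass_less) auto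
    qed
  qed
  ultimately have "A \<in> graph_mats (blowup_graph k d)"
    using car by (simp add: graph_mats_def blowup_graph_def)
  moreover have "C $$ (v, v) = 0" if "v < 2 * k + 4" for v
  proof -
    \<comment> \<open>The leaf test is expressed through the class, so that the six class values
      decide it.\<close>
    have "C $$ (v, v) = parter_inverse_pattern k (of_bool d) (vclass k v) (vclass k v)
        + (if 4 \<le> vclass k v then 1 / 2 else 0)"
      using that by (simp add: C_def blowup_mat_def)
    then show ?thesis
      using vclass_less[of k v] unfolding less_6_cases
      by (elim disjE) (simp_all add: parter_inverse_pattern_def del: vclass_ge_4_iff)
  qed
  then have "det (mat_delete A v v) = 0" if "v \<in> pverts (blowup_graph k d)" for v
    using det_mat_delete_right_inverse(2)[OF car AC, of v] that by (simp add: blowup_graph_def)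
  ultimately show ?thesis
    using det_mat_delete_right_inverse(1)[OF car AC] unfolding parter_graph_def by blast
qed

theorem corollary4p5:
  fixes r :: int
  assumes "r \<ge> 5"
  shows "\<exists>n G. graph_on n G \<and> Digraph_Component.connected (with_proj G) \<and>
    balanced_bipartite G \<and> cycle_rank G = r \<and>
    parter_graph G \<and> \<not> (\<exists>M. perfect_matching G M)"
proof -
  \<comment> \<open>\<open>k\<close> is \<open>r / 2\<close> rounded up: odd
    \<open>r = 2 * k - 1\<close> omits the edge 03 and even \<open>r = 2 * k\<close> includes it.
    The bound \<open>r \<ge> 5\<close> is exactly \<open>k \<ge> 3\<close>.\<close>
  define k where "k = nat ((r + 1) div 2)"
  have k: "k \<ge> 3" "2 * int k - 1 + of_bool (even r) = r"
    using assms by (auto simp: k_def elim!: evenE oddE)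
  have "graph_on (2 * k + 4) (blowup_graph k (even r))"
    using pair_graph_blowup by (simp add: graph_on_def blowup_graph_def)
  moreover have "cycle_rank (blowup_graph k (even r)) = r"
    using k by (simp add: cycle_rank_blowup)
  moreover have "Digraph_Component.connected (with_proj (blowup_graph k (even r)))"
    using k by (simp add: connected_blowup)
  ultimately show ?thesis
    using balanced_bipartite_blowup parter_graph_blowup[OF k(1)] no_perfect_matching_blowup[OF k(1)]
    by blast
qed

end
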